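(* Let $f:\mathbb{R}^d\to\mathbb{R}$ be $L$-smooth ($L>0$) and bounded below with $f^*:=\inf_{x\in\mathbb{R}^d} f(x)>-\infty$, and suppose the stochastic gradient oracle is unbiased with $\sigma$-sub-Gaussian noise, $\sigma>0$. Let $(x_t)_{t\ge1}$ be the iterates of stochastic dual averaging (SDA) with step sizes $\eta_t=\frac{1}{L+\sigma\sqrt t}$, $t\ge1$. Then for every integer $T\ge1$ and every $\delta\in(0,1)$, with probability at least $1-\delta$, $$\frac1T\sum_{t=1}^T\|\nabla f(x_t)\|^2\le\left(6\Delta+18(L+\sigma)\log\left(1+\frac{\sigma\sqrt T}{L}\right)+\frac{36\sigma^2}{L+\sigma}\log\frac1\delta\right)\frac{L+\sigma\sqrt T}{T},$$ where $\Delta:=f(0)-f^*$.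
   Context: $\|\cdot\|$ is the Euclidean norm on $\mathbb{R}^d$. $L$-smooth: $f$ is differentiable and $f(y)\le f(x)+\langle\nabla f(x),y-x\rangle+\frac L2\|y-x\|^2$ for all $x,y\in\mathbb{R}^d$. Stochastic gradient oracle: a query at $x\in\mathbb{R}^d$ returns a random vector $\widehat\nabla f(x)\in\mathbb{R}^d$; different queries use independent randomness. Unbiased: $\mathbb{E}[\widehat\nabla f(x)\mid x]=\nabla f(x)$ for all $x$. $\sigma$-sub-Gaussian noise: $\mathbb{E}\left[\exp\left(\lambda^2\|\widehat\nabla f(x)-\nabla f(x)\|^2\right)\mid x\right]\le\exp(\lambda^2\sigma^2)$ for all $x$ and all $\lambda$ with $|\lambda|\le 1/\sigma$. Along the iterates these hold conditionally on the past: with $g_t:=\widehat\nabla f(x_t)$, $\xi_t:=g_t-\nabla f(x_t)$ and $\mathcal{F}_t:=\sigma(\xi_1,\dots,\xi_{t-1})$ (so $x_t$ is $\mathcal{F}_t$-measurable), $\mathbb{E}[\xi_t\mid\mathcal{F}_t]=0$ and $\mathbb{E}[\exp(\lambda^2\|\xi_t\|^2)\mid\mathcal{F}_t]\le\exp(\lambda^2\sigma^2)$ for $|\lambda|\le1/\sigma$. SDA with step sizes $(\eta_t)_{t\ge1}$: $x_1=0$ and $x_{t+1}=-\eta_t\sum_{i=1}^t g_i$ for $t\ge1$, where $g_i=\widehat\nabla f(x_i)$. *)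

theory Defs
  imports "HOL-Probability.Probability"
begin

definition gradient :: "('a::real_inner \<Rightarrow> real) \<Rightarrow> 'a \<Rightarrow> 'a" where
  "gradient f x = (THE D. GDERIV f x :> D)"

lemma gradient_eqI:
  assumes "GDERIV f x :> D"
  shows "gradient f x = D"
  unfolding gradient_def
proof (rule the_equality)
  fix D' assume "GDERIV f x :> D'"
  with assms have "(\<lambda>h. h \<bullet> D) = (\<lambda>h. h \<bullet> D')"
    unfolding gderiv_def by (rule has_derivative_unique)
  then have "(D - D') \<bullet> (D - D') = 0"
    by (metis inner_diff_right right_minus_eq)
  then show "D' = D" by simp
qed (rule assms)

lemma GDERIV_gradient:
  fixes f :: "'a::euclidean_space \<Rightarrow> real"
  assumes "f differentiable (at x)"
  shows "GDERIV f x :> gradient f x"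
proof -
  obtain f' where f': "(f has_derivative f') (at x)"
    using assms by (auto simp: differentiable_def)
  then interpret linear f' by (rule has_derivative_linear)
  have "f' h = h \<bullet> (\<Sum>b\<in>Basis. f' b *\<^sub>R b)" for h
  proof -
    have "f' h = f' (\<Sum>b\<in>Basis. (h \<bullet> b) *\<^sub>R b)"
      by (simp add: euclidean_representation)
    also have "\<dots> = (\<Sum>b\<in>Basis. (h \<bullet> b) * f' b)"
      by (simp add: sum scale)
    finally show ?thesis
      by (simp add: inner_sum_right mult.commute)
  qed
  then have "f' = (\<lambda>h. h \<bullet> (\<Sum>b\<in>Basis. f' b *\<^sub>R b))" by blast
  with f' have "GDERIV f x :> (\<Sum>b\<in>Basis. f' b *\<^sub>R b)"
    unfolding gderiv_def by simp
  then show ?thesis using gradient_eqI by metis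
qed

definition L_smooth :: "real \<Rightarrow> ('a::real_inner \<Rightarrow> real) \<Rightarrow> bool" where
  "L_smooth L f \<longleftrightarrow>
     (\<forall>x. f differentiable (at x)) \<and>
     (\<forall>x y. f y \<le> f x + gradient f x \<bullet> (y - x) + L / 2 * (norm (y - x))\<^sup>2)"

text \<open>
  A stochastic gradient oracle on the probability space \<open>M\<close> is a random field \<open>G\<close>:
  \<open>G t x \<omega>\<close> is the vector returned by the \<open>t\<close>-th query (\<open>t \<ge> 1\<close>) if it is made at \<open>x\<close>.
\<close>

definition oracle_events ::
    "'w measure \<Rightarrow> (nat \<Rightarrow> 'a::topological_space \<Rightarrow> 'w \<Rightarrow> 'a) \<Rightarrow> nat \<Rightarrow> 'w set set" where
  "oracle_events M G t =
     sigma_sets (space M) {G t x -` A \<inter> space M | x A. A \<in> sets borel}"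

definition independent_queries ::
    "'w measure \<Rightarrow> (nat \<Rightarrow> 'a::topological_space \<Rightarrow> 'w \<Rightarrow> 'a) \<Rightarrow> bool" where
  "independent_queries M G \<longleftrightarrow> prob_space.indep_sets M (oracle_events M G) {1..}"

definition unbiased_oracle ::
    "'w measure \<Rightarrow> ('a::euclidean_space \<Rightarrow> real) \<Rightarrow> (nat \<Rightarrow> 'a \<Rightarrow> 'w \<Rightarrow> 'a) \<Rightarrow> bool" where
  "unbiased_oracle M f G \<longleftrightarrow>
     (\<forall>t\<ge>1. \<forall>x. integrable M (G t x) \<and> (\<integral>\<omega>. G t x \<omega> \<partial>M) = gradient f x)"

definition subgaussian_oracle ::
    "'w measure \<Rightarrow> ('a::euclidean_space \<Rightarrow> real) \<Rightarrow> (nat \<Rightarrow> 'a \<Rightarrow> 'w \<Rightarrow> 'a) \<Rightarrow> real \<Rightarrow> bool" where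
  "subgaussian_oracle M f G \<sigma> \<longleftrightarrow>
     (\<forall>t\<ge>1. \<forall>x. \<forall>l::real. \<bar>l\<bar> \<le> 1 / \<sigma> \<longrightarrow>
        (\<integral>\<^sup>+\<omega>. ennreal (exp (l\<^sup>2 * (norm (G t x \<omega> - gradient f x))\<^sup>2)) \<partial>M)
          \<le> ennreal (exp (l\<^sup>2 * \<sigma>\<^sup>2)))"

definition sda_iterates ::
    "'w measure \<Rightarrow> (nat \<Rightarrow> real) \<Rightarrow> (nat \<Rightarrow> 'a::real_vector \<Rightarrow> 'w \<Rightarrow> 'a) \<Rightarrow> (nat \<Rightarrow> 'w \<Rightarrow> 'a) \<Rightarrow> bool" where
  "sda_iterates M \<eta> G x \<longleftrightarrow>
     (\<forall>\<omega>\<in>space M. x 1 \<omega> = 0 \<and>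
        (\<forall>t\<ge>1. x (t + 1) \<omega> = - \<eta> t *\<^sub>R (\<Sum>i=1..t. G i (x i \<omega>) \<omega>)))"

definition noise ::
    "('a::real_inner \<Rightarrow> real) \<Rightarrow> (nat \<Rightarrow> 'a \<Rightarrow> 'w \<Rightarrow> 'a) \<Rightarrow> (nat \<Rightarrow> 'w \<Rightarrow> 'a) \<Rightarrow> nat \<Rightarrow> 'w \<Rightarrow> 'a" where
  "noise f G x t \<omega> = G t (x t \<omega>) \<omega> - gradient f (x t \<omega>)"

text \<open>The \<open>\<sigma>\<close>-algebra generated by \<open>\<xi> 1, \<dots>, \<xi> (t - 1)\<close>; it is trivial for \<open>t = 1\<close>.\<close>

definition past :: "'w measure \<Rightarrow> (nat \<Rightarrow> 'w \<Rightarrow> 'a::topological_space) \<Rightarrow> nat \<Rightarrow> 'w measure" where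
  "past M \<xi> t = sigma (space M) (\<Union>i\<in>{1..<t}. {\<xi> i -` A \<inter> space M | A. A \<in> sets borel})"

lemma subalgebra_past:
  assumes "\<And>i. 1 \<le> i \<Longrightarrow> i < t \<Longrightarrow> \<xi> i \<in> borel_measurable M"
  shows "subalgebra M (past M \<xi> t)"
proof -
  let ?E = "\<Union>i\<in>{1..<t}. {\<xi> i -` A \<inter> space M | A. A \<in> sets borel}"
  have "?E \<subseteq> sets M"
    using assms by (auto intro: measurable_sets)
  moreover have "?E \<subseteq> Pow (space M)" by blast
  ultimately show ?thesis
    unfolding subalgebra_def past_def
    by (simp only: space_measure_of sets_measure_of sets.sigma_sets_subset)
qed

text \<open>
  The library has conditional expectations of scalar functions only, so that of a vector
  is taken coordinatewise.
\<close>

definition vec_cond_exp ::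
    "'w measure \<Rightarrow> 'w measure \<Rightarrow> ('w \<Rightarrow> 'a::euclidean_space) \<Rightarrow> 'w \<Rightarrow> 'a" where
  "vec_cond_exp M F X \<omega> = (\<Sum>b\<in>Basis. real_cond_exp M F (\<lambda>\<omega>. X \<omega> \<bullet> b) \<omega> *\<^sub>R b)"

text \<open>
  The two noise conditions along a trajectory. Integrability is what makes the library's
  (total) conditional expectation meaningful, and it supplies the measurability of \<open>\<xi> t\<close>.
\<close>

definition cond_unbiased :: "'w measure \<Rightarrow> (nat \<Rightarrow> 'w \<Rightarrow> 'a::euclidean_space) \<Rightarrow> bool" where
  "cond_unbiased M \<xi> \<longleftrightarrow>
     (\<forall>t\<ge>1. integrable M (\<xi> t) \<and> (AE \<omega> in M. vec_cond_exp M (past M \<xi> t) (\<xi> t) \<omega> = 0))"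

definition cond_subgaussian :: "'w measure \<Rightarrow> (nat \<Rightarrow> 'w \<Rightarrow> 'a::euclidean_space) \<Rightarrow> real \<Rightarrow> bool" where
  "cond_subgaussian M \<xi> \<sigma> \<longleftrightarrow>
     (\<forall>t\<ge>1. \<forall>l::real. \<bar>l\<bar> \<le> 1 / \<sigma> \<longrightarrow>
        (AE \<omega> in M. nn_cond_exp M (past M \<xi> t) (\<lambda>\<omega>. ennreal (exp (l\<^sup>2 * (norm (\<xi> t \<omega>))\<^sup>2))) \<omega>
          \<le> ennreal (exp (l\<^sup>2 * \<sigma>\<^sup>2))))"

end

theory Submission
  imports Defs
begin

text \<open>
  Put \<open>a t = L + \<sigma> * sqrt t\<close> and \<open>b t = a t - a (t - 1)\<close>. The SDA recursion is
  \<open>a t *\<^sub>R (x (t + 1) - x t) = - (g t + b t *\<^sub>R x t)\<close>, a stochastic gradient step of length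
  \<open>1 / a t\<close> for the regularized function \<open>f y + b t / 2 * (norm y)\<^sup>2\<close>. These functions decrease
  with \<open>t\<close>, and because \<open>(b t)\<^sup>2 \<le> a t * (b (t - 1) - b t)\<close> their decrease pays for replacing
  the regularized gradient by that of \<open>f\<close>. The noise contributes a martingale term, whose
  exponential moment is absorbed by the squared regularized gradients, and a term of order
  \<open>(L + \<sigma>) * (\<sigma> / a t)\<^sup>2\<close>, which sums to a logarithm. Markov's inequality for the resulting
  exponential supermartingale, at inverse temperature \<open>(L + \<sigma>) / (6 * \<sigma>\<^sup>2)\<close>, gives the tail bound.
\<close>

subsection \<open>Exponential moments of the noise\<close>

text \<open>For \<open>\<bar>x\<bar> \<le> 1\<close> both sides are separated by
  \<open>1 + x + x\<^sup>2\<close>; beyond that, \<open>\<bar>x\<bar> \<le> x\<^sup>2\<close>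
  suffices. Applied to \<open>w \<bullet> \<xi>\<close>, it splits off a linear term of mean zero
  and leaves one governed by the squared noise norm.\<close>

lemma exp_le_add_exp_square: "exp x \<le> x + exp (x\<^sup>2)" for x :: real
proof -
  have sq: "1 + x\<^sup>2 \<le> exp (x\<^sup>2)" by (rule exp_ge_add_one_self)
  consider "x \<ge> 1" | "0 \<le> x" "x \<le> 1" | "-1 \<le> x" "x \<le> 0" | "x \<le> -1" by linarith
  then show ?thesis
  proof cases
    case 1
    then have "x \<le> x\<^sup>2" by (simp add: power2_eq_square)
    then have "exp x \<le> exp (x\<^sup>2)" by simp
    with 1 show ?thesis by linarith
  next
    case 2
    with exp_bound[of x] sq show ?thesis by linarith
  next
    case 3
    \<comment> \<open>The goal is \<open>exp (- y) \<le> 1 - y + y\<^sup>2\<close>. Multiplied by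
      the quadratic Taylor minorant of \<open>exp y\<close>, the right side loses its linear term
      and keeps only nonnegative corrections to 1.\<close>
    define y where "y = - x"
    have y: "0 \<le> y" using 3 by (simp add: y_def)
    have "1 + y + y\<^sup>2 / 2 \<le> exp y" using exp_lower_Taylor_quadratic[OF y] .
    moreover have "0 \<le> 1 - y + y\<^sup>2"
      using sum_squares_ge_zero[of "y - 1/2" 0] by (simp add: power2_eq_square algebra_simps)
    ultimately have "(1 + y + y\<^sup>2 / 2) * (1 - y + y\<^sup>2) \<le> exp y * (1 - y + y\<^sup>2)"
      by (rule mult_right_mono)
    moreover have "(1 + y + y\<^sup>2 / 2) * (1 - y + y\<^sup>2) = 1 + y^2 / 2 + y^3 / 2 + y^4 / 2"
      by (simp add: field_simps power2_eq_square power3_eq_cube power4_eq_xxxx)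
    moreover have "1 \<le> 1 + y^2 / 2 + y^3 / 2 + y^4 / 2" using y by simp
    ultimately have "1 \<le> exp y * (1 - y + y\<^sup>2)" by linarith
    then have "exp x \<le> 1 + x + x\<^sup>2"
      by (simp add: y_def exp_minus field_simps)
    with sq show ?thesis by linarith
  next
    case 4
    then have "exp x \<le> 1" by simp
    moreover have "0 \<le> (-x) * (-x - 1)" using 4 by (intro mult_nonneg_nonneg) auto
    then have "- x \<le> x\<^sup>2" by (simp add: power2_eq_square algebra_simps)
    ultimately show ?thesis using sq by linarith
  qed
qed

text \<open>Convexity of \<open>exp\<close> on the segment from 0 to \<open>z - 1\<close>. It
  replaces Jensen's inequality: when \<open>exp (z - 1)\<close> has conditional mean at most 1, so
  has the right side, which is affine in \<open>exp (z - 1)\<close>.\<close>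

lemma exp_scaled_le:
  fixes p z :: real
  assumes "0 \<le> p" "p \<le> 1"
  shows "exp (p * z - p) \<le> 1 + p * (exp (z - 1) - 1)"
proof -
  have "exp ((1 - p) *\<^sub>R 0 + p *\<^sub>R (z - 1)) \<le> (1 - p) * exp 0 + p * exp (z - 1)"
    using assms by (intro convex_onD[OF exp_convex]) auto
  then show ?thesis by (simp add: algebra_simps)
qed

text \<open>
  The majorant is affine in \<open>\<xi>\<close> and in \<open>exp ((norm \<xi>)\<^sup>2 / \<sigma>\<^sup>2)\<close>, with coefficients that depend on
  \<open>w\<close> only and are bounded. Its conditional expectation can therefore be taken for random \<open>w\<close>,
  and the sub-Gaussian hypothesis is needed only at the single parameter \<open>1 / \<sigma>\<close>.
\<close>

lemma exp_inner_le_affine: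
  fixes w \<xi> :: "'a::real_inner"
  assumes "\<sigma> > 0"
  defines "p \<equiv> \<sigma>\<^sup>2 * (norm w)\<^sup>2"
  shows "exp (w \<bullet> \<xi> - p) \<le> (if p \<le> 1 then exp (- p) *\<^sub>R w else 0) \<bullet> \<xi>
           + 1 + (if p \<le> 1 then p else 1 / 2) * (exp ((norm \<xi>)\<^sup>2 / \<sigma>\<^sup>2 - 1) - 1)"
proof (cases "p \<le> 1")
  case True
  have p0: "0 \<le> p" by (simp add: p_def)
  have "(w \<bullet> \<xi>)\<^sup>2 \<le> (norm w * norm \<xi>)\<^sup>2"
    by (metis Cauchy_Schwarz_ineq2 abs_ge_zero power2_abs power_mono)
  also have "\<dots> = p * ((norm \<xi>)\<^sup>2 / \<sigma>\<^sup>2)"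
    using assms by (simp add: p_def power_mult_distrib)
  finally have "exp ((w \<bullet> \<xi>)\<^sup>2) \<le> exp (p * ((norm \<xi>)\<^sup>2 / \<sigma>\<^sup>2))" by simp
  then have "exp (w \<bullet> \<xi>) \<le> w \<bullet> \<xi> + exp (p * ((norm \<xi>)\<^sup>2 / \<sigma>\<^sup>2))"
    using exp_le_add_exp_square[of "w \<bullet> \<xi>"] by linarith
  then have "exp (- p) * exp (w \<bullet> \<xi>) \<le> exp (- p) * (w \<bullet> \<xi> + exp (p * ((norm \<xi>)\<^sup>2 / \<sigma>\<^sup>2)))"
    by (rule mult_left_mono) simp
  also have "\<dots> = exp (- p) * (w \<bullet> \<xi>) + exp (p * ((norm \<xi>)\<^sup>2 / \<sigma>\<^sup>2) - p)"
    by (simp add: distrib_left mult_exp_exp)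
  also have "\<dots> \<le> exp (- p) * (w \<bullet> \<xi>) + (1 + p * (exp ((norm \<xi>)\<^sup>2 / \<sigma>\<^sup>2 - 1) - 1))"
    by (intro add_left_mono exp_scaled_le p0 True)
  finally show ?thesis using True by (simp add: mult_exp_exp)
next
  case False
  \<comment> \<open>Young's inequality at scale \<open>\<sigma>\<close>. After subtracting
    \<open>p > 1\<close>, the remaining \<open>- p / 2\<close> is below \<open>- 1 / 2\<close>, so
    no linear term is required and the quadratic part enters with weight
    \<open>1 / 2\<close>.\<close>
  have "w \<bullet> \<xi> = (\<sigma> *\<^sub>R w) \<bullet> ((1 / \<sigma>) *\<^sub>R \<xi>)" using assms(1) by simp
  also have "\<dots> \<le> ((norm (\<sigma> *\<^sub>R w))\<^sup>2 + (norm ((1 / \<sigma>) *\<^sub>R \<xi>))\<^sup>2) / 2"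
    unfolding dot_norm_neg by (intro divide_right_mono) auto
  also have "\<dots> = p / 2 + (norm \<xi>)\<^sup>2 / \<sigma>\<^sup>2 / 2"
    using assms(1) by (simp add: p_def power_mult_distrib power_divide add_divide_distrib)
  finally have "w \<bullet> \<xi> \<le> p / 2 + (norm \<xi>)\<^sup>2 / \<sigma>\<^sup>2 / 2" .
  with False have "w \<bullet> \<xi> - p \<le> 1 / 2 * ((norm \<xi>)\<^sup>2 / \<sigma>\<^sup>2) - 1 / 2"
    by simp
  then have "exp (w \<bullet> \<xi> - p) \<le> exp (1 / 2 * ((norm \<xi>)\<^sup>2 / \<sigma>\<^sup>2) - 1 / 2)" by simp
  also have "\<dots> \<le> 1 + 1 / 2 * (exp ((norm \<xi>)\<^sup>2 / \<sigma>\<^sup>2 - 1) - 1)"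
    by (rule exp_scaled_le) auto
  finally show ?thesis using False by simp
qed

text \<open>The left side is the geometric mean of an inner-product factor for
  \<open>2 *\<^sub>R u\<close> and a quadratic factor for \<open>2 * s\<close>, each with its own
  compensator. The arithmetic mean of their affine majorants is again affine; the doubling explains
  the 4 in \<open>p\<close> and the condition
  \<open>2 * s * \<sigma>\<^sup>2 \<le> 1\<close>.\<close>

lemma exp_inner_norm_le_affine:
  fixes u \<xi> :: "'a::real_inner"
  assumes "\<sigma> > 0" "0 \<le> s" "2 * s * \<sigma>\<^sup>2 \<le> 1"
  defines "p \<equiv> 4 * \<sigma>\<^sup>2 * (norm u)\<^sup>2"
  shows "exp (u \<bullet> \<xi> + s * (norm \<xi>)\<^sup>2 - (2 * \<sigma>\<^sup>2 * (norm u)\<^sup>2 + s * \<sigma>\<^sup>2))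
      \<le> (if p \<le> 1 then exp (- p) *\<^sub>R u else 0) \<bullet> \<xi> + 1
         + ((if p \<le> 1 then p else 1 / 2) + 2 * s * \<sigma>\<^sup>2) / 2 * (exp ((norm \<xi>)\<^sup>2 / \<sigma>\<^sup>2 - 1) - 1)"
proof -
  let ?V = "exp ((norm \<xi>)\<^sup>2 / \<sigma>\<^sup>2 - 1)"
  define A where "A = exp ((2 *\<^sub>R u) \<bullet> \<xi> - p)"
  define B where "B = exp (2 * s * \<sigma>\<^sup>2 * ((norm \<xi>)\<^sup>2 / \<sigma>\<^sup>2) - 2 * s * \<sigma>\<^sup>2)"
  have p: "p = \<sigma>\<^sup>2 * (norm (2 *\<^sub>R u))\<^sup>2" by (simp add: p_def power_mult_distrib)
  have "exp (u \<bullet> \<xi> + s * (norm \<xi>)\<^sup>2 - (2 * \<sigma>\<^sup>2 * (norm u)\<^sup>2 + s * \<sigma>\<^sup>2)) = sqrt (A * B)"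
    unfolding A_def B_def mult_exp_exp using assms(1)
    by (intro real_sqrt_unique[symmetric]) (auto simp: p_def exp_double[symmetric] algebra_simps)
  also have "\<dots> \<le> (A + B) / 2"
    by (rule arith_geo_mean_sqrt) (auto simp: A_def B_def)
  finally have 1: "exp (u \<bullet> \<xi> + s * (norm \<xi>)\<^sup>2 - (2 * \<sigma>\<^sup>2 * (norm u)\<^sup>2 + s * \<sigma>\<^sup>2)) \<le> (A + B) / 2" .
  have 2: "B \<le> 1 + 2 * s * \<sigma>\<^sup>2 * (?V - 1)"
    unfolding B_def using assms by (intro exp_scaled_le) auto
  have 3: "A \<le> (if p \<le> 1 then exp (- p) *\<^sub>R (2 *\<^sub>R u) else 0) \<bullet> \<xi>
           + 1 + (if p \<le> 1 then p else 1 / 2) * (?V - 1)"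
    using exp_inner_le_affine[OF assms(1), of "2 *\<^sub>R u" \<xi>] unfolding A_def p by simp
  show ?thesis
    using 1 2 3 by (cases "p \<le> 1") (simp_all add: algebra_simps add_divide_distrib)
qed

section \<open>Conditional exponential moments\<close>

text \<open>The factor \<open>c\<close> is pulled out of the conditional expectation coordinate by
  coordinate; its boundedness keeps every product integrable.\<close>

lemma integral_inner_eq_0_of_vec_cond_exp:
  fixes \<xi> c :: "'w \<Rightarrow> 'a::euclidean_space"
  assumes "prob_space M" and sub: "subalgebra M F"
    and int: "integrable M \<xi>" and zero: "AE \<omega> in M. vec_cond_exp M F \<xi> \<omega> = 0"
    and c[measurable]: "c \<in> borel_measurable F" and bdd: "\<And>\<omega>. norm (c \<omega>) \<le> K"
  shows "integrable M (\<lambda>\<omega>. c \<omega> \<bullet> \<xi> \<omega>)" "(\<integral>\<omega>. c \<omega> \<bullet> \<xi> \<omega> \<partial>M) = 0"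
proof -
  interpret prob_space M by fact
  interpret finite_measure_subalgebra M F by standard (rule sub)
  have cM[measurable]: "c \<in> borel_measurable M" using measurable_from_subalg[OF sub c] .
  have \<xi>M[measurable]: "\<xi> \<in> borel_measurable M" using int by auto
  have ib: "integrable M (\<lambda>\<omega>. (c \<omega> \<bullet> b) * (\<xi> \<omega> \<bullet> b))" if b: "b \<in> Basis" for b
  proof (rule Bochner_Integration.integrable_bound)
    show "integrable M (\<lambda>\<omega>. K * norm (\<xi> \<omega>))" using int by simp
    have "norm ((c \<omega> \<bullet> b) * (\<xi> \<omega> \<bullet> b)) \<le> norm (K * norm (\<xi> \<omega>))" for \<omega>
    proof -
      have "\<bar>c \<omega> \<bullet> b\<bar> * \<bar>\<xi> \<omega> \<bullet> b\<bar> \<le> K * norm (\<xi> \<omega>)"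
        using b bdd[of \<omega>] Basis_le_norm[OF b, of "c \<omega>"] Basis_le_norm[OF b, of "\<xi> \<omega>"]
        by (intro mult_mono) (auto intro: order_trans[OF norm_ge_zero])
      also have "\<dots> \<le> norm (K * norm (\<xi> \<omega>))" by simp
      finally show ?thesis by (simp add: abs_mult)
    qed
    then show "AE \<omega> in M. norm ((c \<omega> \<bullet> b) * (\<xi> \<omega> \<bullet> b)) \<le> norm (K * norm (\<xi> \<omega>))" by simp
  qed simp
  have eq: "(\<lambda>\<omega>. c \<omega> \<bullet> \<xi> \<omega>) = (\<lambda>\<omega>. \<Sum>b\<in>Basis. (c \<omega> \<bullet> b) * (\<xi> \<omega> \<bullet> b))"
    by (rule ext) (rule euclidean_inner)
  show "integrable M (\<lambda>\<omega>. c \<omega> \<bullet> \<xi> \<omega>)" unfolding eq using ib by simp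
  have "(\<integral>\<omega>. (c \<omega> \<bullet> b) * (\<xi> \<omega> \<bullet> b) \<partial>M) = 0" if b: "b \<in> Basis" for b
  proof -
    have "AE \<omega> in M. real_cond_exp M F (\<lambda>\<omega>. \<xi> \<omega> \<bullet> b) \<omega> = 0"
      using zero
    proof eventually_elim
      case (elim \<omega>)
      then have "vec_cond_exp M F \<xi> \<omega> \<bullet> b = 0" by simp
      with b show ?case by (simp add: vec_cond_exp_def inner_sum_left inner_Basis if_distrib cong: if_cong)
    qed
    then have "(\<integral>\<omega>. (c \<omega> \<bullet> b) * real_cond_exp M F (\<lambda>\<omega>. \<xi> \<omega> \<bullet> b) \<omega> \<partial>M) = 0"
      by (intro integral_eq_zero_AE) auto
    with real_cond_exp_intg(2)[OF ib[OF b]] show ?thesis by simp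
  qed
  then show "(\<integral>\<omega>. c \<omega> \<bullet> \<xi> \<omega> \<partial>M) = 0"
    unfolding eq using ib by simp
qed

text \<open>The hypothesis is tested on the set where the conditional expectation exceeds 1. There
  the truncated subtraction of \<open>ennreal\<close> is exact, and finiteness of the measure allows
  \<open>emeasure M A\<close> to be cancelled, so the excess integrates to 0.\<close>

lemma (in sigma_finite_subalgebra) nn_cond_exp_le_1I:
  assumes fin: "emeasure M (space M) < \<infinity>" and W[measurable]: "W \<in> borel_measurable M"
    and le: "\<And>A. A \<in> sets F \<Longrightarrow> (\<integral>\<^sup>+\<omega>. indicator A \<omega> * W \<omega> \<partial>M) \<le> emeasure M A"
  shows "AE \<omega> in M. nn_cond_exp M F W \<omega> \<le> 1"
proof -
  let ?N = "nn_cond_exp M F W"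
  define A where "A = {\<omega> \<in> space F. 1 < ?N \<omega>}"
  have AF[measurable]: "A \<in> sets F" unfolding A_def by measurable
  have AM[measurable]: "A \<in> sets M" using AF subalg by (auto simp: subalgebra_def)
  have "emeasure M A + (\<integral>\<^sup>+\<omega>. indicator A \<omega> * (?N \<omega> - 1) \<partial>M)
      = (\<integral>\<^sup>+\<omega>. indicator A \<omega> + indicator A \<omega> * (?N \<omega> - 1) \<partial>M)"
    by (simp add: nn_integral_add)
  also have "\<dots> = (\<integral>\<^sup>+\<omega>. indicator A \<omega> * ?N \<omega> \<partial>M)"
    by (intro nn_integral_cong) (auto simp: indicator_def A_def)
  also have "\<dots> = (\<integral>\<^sup>+\<omega>. indicator A \<omega> * W \<omega> \<partial>M)"
    by (rule nn_cond_exp_intg) measurable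
  also have "\<dots> \<le> emeasure M A + 0" using le[OF AF] by simp
  finally have "(\<integral>\<^sup>+\<omega>. indicator A \<omega> * (?N \<omega> - 1) \<partial>M) \<le> 0"
    using emeasure_mono[of A "space M" M] fin sets.sets_into_space[OF AM]
    by (subst (asm) ennreal_add_left_cancel_le) (auto simp: top_unique)
  then have "AE \<omega> in M. indicator A \<omega> * (?N \<omega> - 1) = 0"
    by (subst nn_integral_0_iff_AE[symmetric]) auto
  with AE_space show ?thesis
  proof eventually_elim
    case (elim \<omega>)
    then show ?case using subalg
      by (cases "\<omega> \<in> A") (auto simp: A_def subalgebra_def ennreal_minus_eq_0 diff_eq_0_iff_ennreal not_less)
  qed
qed

text \<open>Over a set \<open>A\<close> of \<open>F\<close>, the linear part of the majorant
  integrates to 0, the last part to at most 0 by sub-Gaussianity, and the constant to the measure of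
  \<open>A\<close>.\<close>

lemma nn_cond_exp_affine_le_1:
  fixes \<xi> c :: "'w \<Rightarrow> 'a::euclidean_space"
  assumes "prob_space M" and sub: "subalgebra M F" and "\<sigma> > 0"
    and int: "integrable M \<xi>" and zero: "AE \<omega> in M. vec_cond_exp M F \<xi> \<omega> = 0"
    and sg: "AE \<omega> in M. nn_cond_exp M F (\<lambda>\<omega>. ennreal (exp ((norm (\<xi> \<omega>))\<^sup>2 / \<sigma>\<^sup>2))) \<omega> \<le> ennreal (exp 1)"
    and c[measurable]: "c \<in> borel_measurable F" and bdd: "\<And>\<omega>. norm (c \<omega>) \<le> K"
    and \<beta>[measurable]: "\<beta> \<in> borel_measurable F" and \<beta>01: "\<And>\<omega>. 0 \<le> \<beta> \<omega>" "\<And>\<omega>. \<beta> \<omega> \<le> 1"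
    and W[measurable]: "W \<in> borel_measurable M" and W0: "\<And>\<omega>. 0 \<le> W \<omega>"
    and le: "\<And>\<omega>. W \<omega> \<le> c \<omega> \<bullet> \<xi> \<omega> + 1 + \<beta> \<omega> * (exp ((norm (\<xi> \<omega>))\<^sup>2 / \<sigma>\<^sup>2 - 1) - 1)"
  shows "AE \<omega> in M. nn_cond_exp M F (\<lambda>\<omega>. ennreal (W \<omega>)) \<omega> \<le> 1"
proof -
  interpret prob_space M by fact
  interpret finite_measure_subalgebra M F by standard (rule sub)
  have [measurable]: "\<xi> \<in> borel_measurable M" using int by auto
  have [measurable]: "c \<in> borel_measurable M" "\<beta> \<in> borel_measurable M"
    using measurable_from_subalg[OF sub] c \<beta> by blast+
  define V where "V = (\<lambda>\<omega>. exp ((norm (\<xi> \<omega>))\<^sup>2 / \<sigma>\<^sup>2 - 1))"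
  have [measurable]: "V \<in> borel_measurable M" unfolding V_def by measurable
  \<comment> \<open>\<open>V\<close> has conditional mean at most 1, so weighting by a nonnegative
    \<open>F\<close>-measurable \<open>\<gamma>\<close> preserves the comparison. It is stated for
    nonnegative integrals because integrability of the product is deduced from it.\<close>
  have nnV: "(\<integral>\<^sup>+\<omega>. ennreal (\<gamma> \<omega> * V \<omega>) \<partial>M) \<le> (\<integral>\<^sup>+\<omega>. ennreal (\<gamma> \<omega>) \<partial>M)"
    if [measurable]: "\<gamma> \<in> borel_measurable F" and \<gamma>0: "\<And>\<omega>. 0 \<le> \<gamma> \<omega>" for \<gamma>
  proof -
    have "(\<integral>\<^sup>+\<omega>. ennreal (\<gamma> \<omega> * V \<omega>) \<partial>M)
        = (\<integral>\<^sup>+\<omega>. ennreal (\<gamma> \<omega> * exp (- 1)) * ennreal (exp ((norm (\<xi> \<omega>))\<^sup>2 / \<sigma>\<^sup>2)) \<partial>M)"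
      using \<gamma>0 by (intro nn_integral_cong)
        (simp add: V_def ennreal_mult[symmetric] mult_exp_exp mult.assoc)
    also have "\<dots> = (\<integral>\<^sup>+\<omega>. ennreal (\<gamma> \<omega> * exp (- 1))
        * nn_cond_exp M F (\<lambda>\<omega>. ennreal (exp ((norm (\<xi> \<omega>))\<^sup>2 / \<sigma>\<^sup>2))) \<omega> \<partial>M)"
      by (rule nn_cond_exp_intg[symmetric]) measurable
    also have "\<dots> \<le> (\<integral>\<^sup>+\<omega>. ennreal (\<gamma> \<omega> * exp (- 1)) * ennreal (exp 1) \<partial>M)"
      using sg by (intro nn_integral_mono_AE, eventually_elim) (rule mult_left_mono, auto)
    also have "\<dots> = (\<integral>\<^sup>+\<omega>. ennreal (\<gamma> \<omega>) \<partial>M)"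
      using \<gamma>0 by (intro nn_integral_cong) (simp add: ennreal_mult[symmetric] mult_exp_exp mult.assoc)
    finally show ?thesis .
  qed
  show ?thesis
  proof (rule nn_cond_exp_le_1I)
    fix A assume AF[measurable]: "A \<in> sets F"
    have AM[measurable]: "A \<in> sets M" using AF subalg by (auto simp: subalgebra_def)
    define i where "i = (\<lambda>\<omega>. indicator A \<omega> :: real)"
    have i01: "0 \<le> i \<omega>" "i \<omega> \<le> 1" for \<omega> by (auto simp: i_def indicator_def)
    have [measurable]: "i \<in> borel_measurable F" "i \<in> borel_measurable M" by (auto simp: i_def)
    have K: "norm (i \<omega> *\<^sub>R c \<omega>) \<le> K" for \<omega>
      using bdd[of \<omega>] order_trans[OF norm_ge_zero bdd] by (auto simp: i_def indicator_def)
    note ic = integral_inner_eq_0_of_vec_cond_exp[OF \<open>prob_space M\<close> sub int zero _ K]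
    have g0: "0 \<le> i \<omega> * \<beta> \<omega>" "i \<omega> * \<beta> \<omega> \<le> 1" for \<omega>
      using i01 \<beta>01 by (auto intro: mult_le_one)
    have ig: "integrable M (\<lambda>\<omega>. i \<omega> * \<beta> \<omega>)"
      using g0 by (intro integrable_const_bound[of _ 1]) auto
    have fin: "(\<integral>\<^sup>+\<omega>. ennreal (i \<omega> * \<beta> \<omega>) \<partial>M) < \<infinity>"
      using ig g0 by (simp add: integrable_iff_bounded)
    have le': "(\<integral>\<^sup>+\<omega>. ennreal (i \<omega> * \<beta> \<omega> * V \<omega>) \<partial>M) \<le> (\<integral>\<^sup>+\<omega>. ennreal (i \<omega> * \<beta> \<omega>) \<partial>M)"
      using g0 by (intro nnV) auto
    have V0: "0 \<le> V \<omega>" for \<omega> by (simp add: V_def)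
    have igV: "integrable M (\<lambda>\<omega>. i \<omega> * \<beta> \<omega> * V \<omega>)"
      using le' fin g0 V0 by (intro integrableI_nonneg) auto
    have leV: "(\<integral>\<omega>. i \<omega> * \<beta> \<omega> * V \<omega> \<partial>M) \<le> (\<integral>\<omega>. i \<omega> * \<beta> \<omega> \<partial>M)"
      using le' ig igV g0 V0 by (subst (asm) (1 2) nn_integral_eq_integral) (auto intro!: integral_nonneg_AE)
    have ii: "integrable M i" "(\<integral>\<omega>. i \<omega> \<partial>M) = measure M A"
      using i01 by (intro integrable_const_bound[of _ 1]) (auto simp: i_def)
    let ?B = "\<lambda>\<omega>. (i \<omega> *\<^sub>R c \<omega>) \<bullet> \<xi> \<omega> + i \<omega> + (i \<omega> * \<beta> \<omega> * V \<omega> - i \<omega> * \<beta> \<omega>)"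
    have B: "i \<omega> * W \<omega> \<le> ?B \<omega>" for \<omega>
      using mult_left_mono[OF le[of \<omega>] i01(1)[of \<omega>]] by (simp add: V_def algebra_simps)
    \<comment> \<open>The summands of \<open>?B\<close> may be negative, but \<open>?B\<close>
      dominates a nonnegative function; this permits passing from the nonnegative to the Bochner
      integral.\<close>
    have B0: "0 \<le> ?B \<omega>" for \<omega>
      using mult_nonneg_nonneg[OF i01(1) W0] B by (rule order_trans)
    have iB: "integrable M ?B" using ic(1) ii(1) ig igV by auto
    have "(\<integral>\<^sup>+\<omega>. indicator A \<omega> * ennreal (W \<omega>) \<partial>M) = (\<integral>\<^sup>+\<omega>. ennreal (i \<omega> * W \<omega>) \<partial>M)"
      by (intro nn_integral_cong) (auto simp: i_def indicator_def)
    also have "\<dots> \<le> (\<integral>\<^sup>+\<omega>. ennreal (?B \<omega>) \<partial>M)"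
      using B by (intro nn_integral_mono ennreal_leI)
    also have "\<dots> = ennreal (\<integral>\<omega>. ?B \<omega> \<partial>M)"
      using iB B0 by (intro nn_integral_eq_integral) auto
    also have "(\<integral>\<omega>. ?B \<omega> \<partial>M) \<le> measure M A"
      using ic ii ig igV leV by simp
    finally show "(\<integral>\<^sup>+\<omega>. indicator A \<omega> * ennreal (W \<omega>) \<partial>M) \<le> emeasure M A"
      by (simp add: emeasure_eq_measure ennreal_leI)
  qed (auto simp: emeasure_space_1)
qed

lemma nn_cond_exp_exp_le_1:
  fixes \<xi> u :: "'w \<Rightarrow> 'a::euclidean_space"
  assumes "prob_space M" and sub: "subalgebra M F" and "\<sigma> > 0"
    and int: "integrable M \<xi>" and zero: "AE \<omega> in M. vec_cond_exp M F \<xi> \<omega> = 0"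
    and sg: "AE \<omega> in M. nn_cond_exp M F (\<lambda>\<omega>. ennreal (exp ((norm (\<xi> \<omega>))\<^sup>2 / \<sigma>\<^sup>2))) \<omega> \<le> ennreal (exp 1)"
    and u[measurable]: "u \<in> borel_measurable F" and s: "0 \<le> s" "2 * s * \<sigma>\<^sup>2 \<le> 1"
  shows "AE \<omega> in M. nn_cond_exp M F (\<lambda>\<omega>. ennreal (exp (u \<omega> \<bullet> \<xi> \<omega> + s * (norm (\<xi> \<omega>))\<^sup>2
           - (2 * \<sigma>\<^sup>2 * (norm (u \<omega>))\<^sup>2 + s * \<sigma>\<^sup>2)))) \<omega> \<le> 1"
proof -
  have [measurable]: "\<xi> \<in> borel_measurable M" "u \<in> borel_measurable M"
    using int measurable_from_subalg[OF sub u] by auto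
  let ?p = "\<lambda>\<omega>. 4 * \<sigma>\<^sup>2 * (norm (u \<omega>))\<^sup>2"
  \<comment> \<open>The cutoff in the affine majorant is what bounds the coefficient of
    \<open>\<xi>\<close>: it forces \<open>2 * \<sigma> * norm (u \<omega>) \<le> 1\<close>,
    although \<open>u\<close> itself may be unbounded.\<close>
  have bdd: "norm (if ?p \<omega> \<le> 1 then exp (- ?p \<omega>) *\<^sub>R u \<omega> else 0) \<le> 1 / \<sigma>" for \<omega>
  proof (cases "?p \<omega> \<le> 1")
    case True
    have "(\<sigma> * norm (u \<omega>))\<^sup>2 \<le> ?p \<omega>" by (simp add: power_mult_distrib)
    with True have "(\<sigma> * norm (u \<omega>))\<^sup>2 \<le> 1\<^sup>2" by simp
    then have "\<sigma> * norm (u \<omega>) \<le> 1" by (rule power2_le_imp_le) simp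
    then have "norm (u \<omega>) \<le> 1 / \<sigma>" using \<open>\<sigma> > 0\<close> by (simp add: field_simps)
    moreover have "exp (- ?p \<omega>) * norm (u \<omega>) \<le> 1 * norm (u \<omega>)"
      by (intro mult_right_mono) auto
    ultimately show ?thesis using True by simp
  next
    case False
    then show ?thesis using \<open>\<sigma> > 0\<close> by simp
  qed
  show ?thesis
  proof (rule nn_cond_exp_affine_le_1[OF assms(1-6) _ bdd])
    show "((if ?p \<omega> \<le> 1 then ?p \<omega> else 1 / 2) + 2 * s * \<sigma>\<^sup>2) / 2 \<le> 1" for \<omega>
      using s by auto
    show "0 \<le> ((if ?p \<omega> \<le> 1 then ?p \<omega> else 1 / 2) + 2 * s * \<sigma>\<^sup>2) / 2" for \<omega>
      using s by auto
      show "exp (u \<omega> \<bullet> \<xi> \<omega> + s * (norm (\<xi> \<omega>))\<^sup>2 - (2 * \<sigma>\<^sup>2 * (norm (u \<omega>))\<^sup>2 + s * \<sigma>\<^sup>2))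
      \<le> (if ?p \<omega> \<le> 1 then exp (- ?p \<omega>) *\<^sub>R u \<omega> else 0) \<bullet> \<xi> \<omega> + 1
         + ((if ?p \<omega> \<le> 1 then ?p \<omega> else 1 / 2) + 2 * s * \<sigma>\<^sup>2) / 2
           * (exp ((norm (\<xi> \<omega>))\<^sup>2 / \<sigma>\<^sup>2 - 1) - 1)" for \<omega>
      by (rule exp_inner_norm_le_affine[OF \<open>\<sigma> > 0\<close> s])
  qed simp_all
qed

text \<open>The partial products of the \<open>exp (X t)\<close> form a nonnegative supermartingale, to which
  Markov's inequality applies.\<close>

lemma prob_sum_le_ln:
  fixes X :: "nat \<Rightarrow> 'w \<Rightarrow> real" and F :: "nat \<Rightarrow> 'w measure"
  assumes "prob_space M" and sub: "\<And>t. t \<ge> 1 \<Longrightarrow> subalgebra M (F t)"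
    and X: "\<And>t. t \<ge> 1 \<Longrightarrow> X t \<in> borel_measurable M"
    and XF: "\<And>s t. 1 \<le> s \<Longrightarrow> s < t \<Longrightarrow> X s \<in> borel_measurable (F t)"
    and le: "\<And>t. t \<ge> 1 \<Longrightarrow> AE \<omega> in M. nn_cond_exp M (F t) (\<lambda>\<omega>. ennreal (exp (X t \<omega>))) \<omega> \<le> 1"
    and "0 < \<delta>"
  shows "1 - \<delta> \<le> measure M {\<omega> \<in> space M. (\<Sum>t=1..T. X t \<omega>) \<le> ln (1 / \<delta>)}"
proof -
  interpret prob_space M by fact
  let ?S = "\<lambda>n \<omega>. \<Sum>t=1..n. X t \<omega>"
  have S[measurable]: "?S n \<in> borel_measurable M" for n
    using X by (intro borel_measurable_sum) auto
  have E: "(\<integral>\<^sup>+\<omega>. ennreal (exp (?S n \<omega>)) \<partial>M) \<le> 1" for n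
  proof (induction n)
    case 0
    then show ?case by (simp add: emeasure_space_1)
  next
    case (Suc n)
    interpret finite_measure_subalgebra M "F (Suc n)" by standard (rule sub, simp)
    have [measurable]: "?S n \<in> borel_measurable (F (Suc n))"
      using XF by (intro borel_measurable_sum) auto
    have [measurable]: "X (Suc n) \<in> borel_measurable M" using X by simp
    have "(\<integral>\<^sup>+\<omega>. ennreal (exp (?S (Suc n) \<omega>)) \<partial>M)
        = (\<integral>\<^sup>+\<omega>. ennreal (exp (?S n \<omega>)) * ennreal (exp (X (Suc n) \<omega>)) \<partial>M)"
      by (intro nn_integral_cong) (simp add: exp_add ennreal_mult)
    also have "\<dots> = (\<integral>\<^sup>+\<omega>. ennreal (exp (?S n \<omega>))
        * nn_cond_exp M (F (Suc n)) (\<lambda>\<omega>. ennreal (exp (X (Suc n) \<omega>))) \<omega> \<partial>M)"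
      by (rule nn_cond_exp_intg[symmetric]) measurable
    also have "\<dots> \<le> (\<integral>\<^sup>+\<omega>. ennreal (exp (?S n \<omega>)) * 1 \<partial>M)"
    proof (rule nn_integral_mono_AE)
      have "AE \<omega> in M. nn_cond_exp M (F (Suc n)) (\<lambda>\<omega>. ennreal (exp (X (Suc n) \<omega>))) \<omega> \<le> 1"
        by (rule le) simp
      then show "AE \<omega> in M. ennreal (exp (?S n \<omega>))
          * nn_cond_exp M (F (Suc n)) (\<lambda>\<omega>. ennreal (exp (X (Suc n) \<omega>))) \<omega> \<le> ennreal (exp (?S n \<omega>)) * 1"
        by eventually_elim (rule mult_left_mono, auto)
    qed
    also have "\<dots> \<le> 1" using Suc.IH by simp
    finally show ?case .
  qed
  \<comment> \<open>The exceptional event in the form of Markov's inequality; off it,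
    \<open>exp (?S T \<omega>) < 1 / \<delta>\<close>.\<close>
  let ?B = "{\<omega> \<in> space M. 1 \<le> ennreal \<delta> * ennreal (exp (?S T \<omega>))}"
  have B: "?B \<in> sets M" by measurable
  have "emeasure M ?B \<le> ennreal \<delta> * (\<integral>\<^sup>+\<omega>. ennreal (exp (?S T \<omega>)) * indicator (space M) \<omega> \<partial>M)"
    by (rule nn_integral_Markov_inequality) measurable
  also have "\<dots> = ennreal \<delta> * (\<integral>\<^sup>+\<omega>. ennreal (exp (?S T \<omega>)) \<partial>M)"
    by (intro arg_cong2[where f="(*)"] nn_integral_cong refl) auto
  also have "\<dots> \<le> ennreal \<delta> * 1" by (intro mult_left_mono E) auto
  finally have "measure M ?B \<le> \<delta>"
    using \<open>0 < \<delta>\<close> by (simp add: emeasure_eq_measure Int_absorb2)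
  then have "1 - \<delta> \<le> measure M (space M - ?B)"
    by (subst prob_compl[OF B]) simp
  also have "\<dots> \<le> measure M {\<omega> \<in> space M. ?S T \<omega> \<le> ln (1 / \<delta>)}"
  proof (rule finite_measure_mono)
    have "?S T \<omega> \<le> ln (1 / \<delta>)" if "\<omega> \<in> space M - ?B" for \<omega>
    proof -
      have "\<not> 1 \<le> \<delta> * exp (?S T \<omega>)"
        using that \<open>0 < \<delta>\<close> by (auto simp: ennreal_mult[symmetric] ennreal_ge_1)
      then have "exp (?S T \<omega>) \<le> 1 / \<delta>" using \<open>0 < \<delta>\<close> by (simp add: field_simps)
      then show ?thesis using \<open>0 < \<delta>\<close> by (subst ln_ge_iff) auto
    qed
    then show "space M - ?B \<subseteq> {\<omega> \<in> space M. ?S T \<omega> \<le> ln (1 / \<delta>)}" by blast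
  qed measurable
  finally show ?thesis .
qed

subsection \<open>Descent along the SDA trajectory\<close>

text \<open>Each partial derivative is a pointwise limit of difference quotients of the continuous
  function \<open>f\<close>, taken at the increments \<open>inverse (real (Suc n))\<close>.\<close>

lemma borel_measurable_gradient:
  fixes f :: "'a::euclidean_space \<Rightarrow> real"
  assumes diff: "\<And>x. f differentiable (at x)"
  shows "gradient f \<in> borel_measurable borel"
proof (subst borel_measurable_euclidean_space, intro ballI)
  fix b :: 'a assume "b \<in> Basis"
  have "continuous_on UNIV f"
    using diff by (auto intro!: continuous_at_imp_continuous_on differentiable_imp_continuous_within)
  then have [measurable]: "f \<in> borel_measurable borel" by (rule borel_measurable_continuous_onI)
  show "(\<lambda>x. gradient f x \<bullet> b) \<in> borel_measurable borel"
  proof (rule borel_measurable_LIMSEQ_real)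
    fix x
    have g: "(f has_derivative (\<lambda>h. h \<bullet> gradient f x)) (at (x + 0 *\<^sub>R b))"
      using GDERIV_gradient[OF diff] by (simp add: gderiv_def)
    have "((\<lambda>t. x + t *\<^sub>R b) has_derivative (\<lambda>t. t *\<^sub>R b)) (at (0::real))"
      by (auto intro!: derivative_eq_intros)
    from has_derivative_compose[OF this g]
    have "((\<lambda>t. f (x + t *\<^sub>R b)) has_real_derivative (gradient f x \<bullet> b)) (at 0)"
      by (simp add: has_field_derivative_def inner_commute mult_commute_abs)
    then have lim: "((\<lambda>t. (f (x + t *\<^sub>R b) - f x) / t) \<longlongrightarrow> gradient f x \<bullet> b) (at 0)"
      by (simp add: has_field_derivative_iff)
    have "filterlim (\<lambda>n. inverse (real (Suc n))) (at 0) sequentially"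
      using LIMSEQ_inverse_real_of_nat by (auto simp: filterlim_at)
    from filterlim_compose[OF lim this]
    show "(\<lambda>n. (f (x + inverse (real (Suc n)) *\<^sub>R b) - f x) / inverse (real (Suc n)))
        \<longlonglongrightarrow> gradient f x \<bullet> b" .
  qed measurable
qed

text \<open>The function \<open>f z + b / 2 * (norm z)\<^sup>2\<close> obeys the quadratic upper
  bound with constant \<open>L + b\<close> and has gradient \<open>h\<close> at \<open>x\<close>.
  The claim is that bound at the noisy step of length \<open>1 / a\<close>, expanded;
  \<open>\<kappa>\<close> compares the smoothness constant with the inverse step.\<close>

lemma regularized_descent_step:
  fixes f :: "'a::real_inner \<Rightarrow> real"
  assumes smooth: "L_smooth L f" and "a > 0"
    and step: "a *\<^sub>R (y - x) = - (h + \<xi>)"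
    and h: "h = gradient f x + b *\<^sub>R x" and \<kappa>: "\<kappa> = (L + b) / a"
  shows "f y + b / 2 * (norm y)\<^sup>2 \<le> f x + b / 2 * (norm x)\<^sup>2 - (1 - \<kappa> / 2) / a * (norm h)\<^sup>2
           - (1 - \<kappa>) / a * (h \<bullet> \<xi>) + \<kappa> / (2 * a) * (norm \<xi>)\<^sup>2"
proof -
  define d where "d = y - x"
  have y: "y = x + d" by (simp add: d_def)
  have ad: "a *\<^sub>R d = - (h + \<xi>)" using step by (simp add: d_def)
  have "f y \<le> f x + gradient f x \<bullet> d + L / 2 * (norm d)\<^sup>2"
    using smooth unfolding L_smooth_def d_def by blast
  moreover have "(norm y)\<^sup>2 = (norm x)\<^sup>2 + 2 * (x \<bullet> d) + (norm d)\<^sup>2"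
    unfolding y power2_norm_eq_inner by (simp add: inner_add_left inner_add_right inner_commute)
  ultimately have 1: "f y + b / 2 * (norm y)\<^sup>2
      \<le> f x + b / 2 * (norm x)\<^sup>2 + h \<bullet> d + (L + b) / 2 * (norm d)\<^sup>2"
    unfolding h by (simp add: inner_add_left algebra_simps add_divide_distrib)
  have "a * (h \<bullet> d) = - ((norm h)\<^sup>2 + h \<bullet> \<xi>)"
    unfolding inner_scaleR_right[symmetric] ad
    by (simp add: power2_norm_eq_inner inner_add_right inner_diff_right)
  then have 2: "h \<bullet> d = - ((norm h)\<^sup>2 + h \<bullet> \<xi>) / a"
    using \<open>a > 0\<close> by (simp add: field_simps)
  have "a\<^sup>2 * (norm d)\<^sup>2 = (norm (a *\<^sub>R d))\<^sup>2" by (simp add: power_mult_distrib)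
  also have "\<dots> = (norm h)\<^sup>2 + 2 * (h \<bullet> \<xi>) + (norm \<xi>)\<^sup>2"
    unfolding ad norm_minus_cancel power2_norm_eq_inner
    by (simp add: inner_add_left inner_add_right inner_commute)
  finally have 3: "(norm d)\<^sup>2 = ((norm h)\<^sup>2 + 2 * (h \<bullet> \<xi>) + (norm \<xi>)\<^sup>2) / a\<^sup>2"
    using \<open>a > 0\<close> by (simp add: field_simps)
  have "h \<bullet> d + (L + b) / 2 * (norm d)\<^sup>2 = - ((1 - \<kappa> / 2) / a * (norm h)\<^sup>2)
           - (1 - \<kappa>) / a * (h \<bullet> \<xi>) + \<kappa> / (2 * a) * (norm \<xi>)\<^sup>2"
    unfolding 2 3 \<kappa> using \<open>a > 0\<close> by (simp add: field_simps power2_eq_square)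
  with 1 show ?thesis by linarith
qed

section \<open>Estimates for the step sizes\<close>

definition inv_step :: "real \<Rightarrow> real \<Rightarrow> nat \<Rightarrow> real" where
  "inv_step L \<sigma> t = L + \<sigma> * sqrt (real t)"

text \<open>The convention \<open>sqrt (- 1) = - 1\<close> makes \<open>inv_step_diff \<sigma> 0 = \<sigma>\<close>; it is only ever
  multiplied by \<open>x 1 = 0\<close>.\<close>

definition inv_step_diff :: "real \<Rightarrow> nat \<Rightarrow> real" where
  "inv_step_diff \<sigma> t = \<sigma> * (sqrt (real t) - sqrt (real t - 1))"

lemma inv_step_Suc: "inv_step L \<sigma> (Suc t) = inv_step L \<sigma> t + inv_step_diff \<sigma> (Suc t)"
  by (simp add: inv_step_def inv_step_diff_def algebra_simps)

lemma inv_step_mono: "0 \<le> \<sigma> \<Longrightarrow> s \<le> t \<Longrightarrow> inv_step L \<sigma> s \<le> inv_step L \<sigma> t"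
  by (auto simp: inv_step_def intro!: mult_left_mono)

lemma inv_step_ge:
  assumes "0 \<le> \<sigma>" "1 \<le> t"
  shows "L + \<sigma> \<le> inv_step L \<sigma> t"
  using inv_step_mono[OF assms, of L] by (simp add: inv_step_def)

lemma inv_step_diff_bounds:
  assumes "0 \<le> \<sigma>" "1 \<le> t"
  shows "0 \<le> inv_step_diff \<sigma> t" "inv_step_diff \<sigma> t \<le> \<sigma>"
proof -
  have "sqrt (real t) = sqrt (real t - 1 + 1)" by simp
  also have "\<dots> \<le> sqrt (real t - 1) + sqrt 1"
    using assms by (intro sqrt_add_le_add_sqrt) auto
  finally have "sqrt (real t) - sqrt (real t - 1) \<le> 1" by simp
  then show "inv_step_diff \<sigma> t \<le> \<sigma>"
    unfolding inv_step_diff_def using assms by (intro mult_left_le) auto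
  show "0 \<le> inv_step_diff \<sigma> t"
    unfolding inv_step_diff_def using assms by simp
qed

text \<open>Consecutive root differences are \<open>A = 1 / (r + s)\<close> and
  \<open>B = 1 / (s + q)\<close>. Clearing denominators in
  \<open>A\<^sup>2 \<le> r * (B - A)\<close> leaves \<open>A * (s + q) \<le> r * (r - q)\<close>,
  which follows from \<open>r\<^sup>2 - q\<^sup>2 = 2\<close>. The resulting
  \<open>A \<le> B\<close> lets \<open>L\<close> be added to the first factor.\<close>

lemma inv_step_diff_square_le:
  assumes "0 \<le> \<sigma>" "0 < L" "1 \<le> t"
  shows "(inv_step_diff \<sigma> (Suc t))\<^sup>2
           \<le> inv_step L \<sigma> (Suc t) * (inv_step_diff \<sigma> t - inv_step_diff \<sigma> (Suc t))"
proof -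
  define r s q where "r = sqrt (real (Suc t))" and "s = sqrt (real t)" and "q = sqrt (real t - 1)"
  have ord: "0 \<le> q" "q \<le> s" "s < r" using assms by (auto simp: r_def s_def q_def)
  have sq: "r\<^sup>2 = s\<^sup>2 + 1" "s\<^sup>2 = q\<^sup>2 + 1" using assms by (auto simp: r_def s_def q_def)
  define A B where "A = r - s" and "B = s - q"
  have A: "A * (r + s) = 1" and B: "B * (s + q) = 1"
    using sq by (auto simp: A_def B_def power2_eq_square algebra_simps)
  have pos: "0 < s + q" "0 < r + s" "0 \<le> A" using ord B by (auto simp: A_def less_le)
  have "A * (s + q) \<le> A * (r + s)" using ord pos by (intro mult_left_mono) auto
  also have "\<dots> \<le> (r + q) * (r - q) / 2" using A sq by (simp add: power2_eq_square algebra_simps)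
  also have "\<dots> \<le> r * (r - q)"
    using mult_right_mono[of "r + q" "2 * r" "r - q"] ord by simp
  finally have 1: "A * (s + q) \<le> r * (r - q)" .
  have "A\<^sup>2 * ((r + s) * (s + q)) = (A * (r + s)) * (A * (s + q))"
    by (simp add: power2_eq_square)
  also have "\<dots> \<le> r * ((r + s) - (s + q))" using 1 A by simp
  also have "\<dots> = r * ((B * (s + q)) * (r + s) - (A * (r + s)) * (s + q))" unfolding A B by simp
  also have "\<dots> = r * (B - A) * ((r + s) * (s + q))" by (simp add: algebra_simps)
  finally have AB: "A\<^sup>2 \<le> r * (B - A)" using pos by simp
  then have "0 \<le> r * (B - A)" by (meson order_trans zero_le_power2)
  then have BA: "0 \<le> B - A" using ord by (simp add: zero_le_mult_iff)
  have "(\<sigma> * A)\<^sup>2 \<le> \<sigma>\<^sup>2 * (r * (B - A))" using AB by (simp add: power_mult_distrib mult_left_mono)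
  also have "\<dots> = (\<sigma> * r) * (\<sigma> * (B - A))" by (simp add: power2_eq_square)
  also have "\<dots> \<le> (L + \<sigma> * r) * (\<sigma> * (B - A))"
    using assms BA by (intro mult_right_mono) auto
  finally show ?thesis
    by (simp add: inv_step_def inv_step_diff_def A_def B_def r_def s_def q_def algebra_simps)
qed

text \<open>Each term is at most \<open>2 * (1 - ?a n / ?a (Suc n))\<close>, hence at most twice an
  increment of \<open>ln\<close> along \<open>?a\<close>. The sum telescopes down to
  \<open>?a 0 = L\<close>.\<close>

lemma sum_inv_step_square_le:
  assumes "0 < \<sigma>" "0 < L"
  shows "(\<Sum>t=1..n. \<sigma>\<^sup>2 / (inv_step L \<sigma> t)\<^sup>2) \<le> 2 * ln (1 + \<sigma> * sqrt (real n) / L)"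
proof (induction n)
  case 0
  then show ?case by simp
next
  case (Suc n)
  let ?a = "inv_step L \<sigma>"
  have a: "0 < ?a t" for t using assms by (auto simp: inv_step_def intro!: add_pos_nonneg)
  have eq: "1 + \<sigma> * sqrt (real t) / L = ?a t / L" for t
    using assms by (simp add: inv_step_def field_simps)
  define r s where "r = sqrt (real (Suc n))" and "s = sqrt (real n)"
  have rs: "0 < r" "0 \<le> s" "s \<le> r" "r\<^sup>2 = s\<^sup>2 + 1" by (auto simp: r_def s_def)
  have "1 = (r - s) * (r + s)" using rs by (simp add: power2_eq_square algebra_simps)
  also have "\<dots> \<le> (r - s) * (2 * r)" using rs by (intro mult_left_mono) auto
  finally have "\<sigma> * 1 \<le> \<sigma> * ((r - s) * (2 * r))" using assms by (intro mult_left_mono) auto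
  then have "\<sigma> * \<sigma> \<le> (\<sigma> * ((r - s) * (2 * r))) * \<sigma>" using assms by simp
  also have "\<dots> = 2 * (\<sigma> * (r - s)) * (\<sigma> * r)" by (simp add: algebra_simps)
  also have "\<dots> \<le> 2 * (\<sigma> * (r - s)) * ?a (Suc n)"
    using assms rs by (intro mult_left_mono) (auto simp: inv_step_def r_def)
  also have "\<sigma> * (r - s) = ?a (Suc n) - ?a n" by (simp add: inv_step_def r_def s_def algebra_simps)
  finally have "\<sigma>\<^sup>2 / (?a (Suc n))\<^sup>2 \<le> 2 * (?a (Suc n) - ?a n) * ?a (Suc n) / (?a (Suc n))\<^sup>2"
    by (intro divide_right_mono) (auto simp: power2_eq_square)
  also have "\<dots> = 2 * (1 - ?a n / ?a (Suc n))"
    using a[of "Suc n"] by (simp add: field_simps power2_eq_square)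
  also have "\<dots> \<le> 2 * (- ln (?a n / ?a (Suc n)))"
    using ln_le_minus_one[of "?a n / ?a (Suc n)"] a by simp
  also have "\<dots> = 2 * ln (?a (Suc n) / L) - 2 * ln (?a n / L)"
    using a[of n] a[of "Suc n"] assms by (simp add: ln_div)
  finally show ?case using Suc.IH unfolding eq by simp
qed

section \<open>The energy inequality\<close>

text \<open>Induction with the energy
  \<open>f (x (Suc n)) + b n / 2 * (norm (x (Suc n)))\<^sup>2\<close>. Lowering the weight from
  \<open>b n\<close> to \<open>b (Suc n)\<close> at a fixed point releases the term in
  \<open>b t *\<^sub>R x t\<close>; the descent step then supplies the others.\<close>

lemma sda_energy_bound:
  fixes f :: "'a::real_inner \<Rightarrow> real" and x \<xi> :: "nat \<Rightarrow> 'a"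
  assumes "0 < L" "0 < \<sigma>" and smooth: "L_smooth L f" and x1: "x 1 = 0"
    and iter: "\<And>t. t \<ge> 1 \<Longrightarrow>
      x (t + 1) = - (1 / inv_step L \<sigma> t) *\<^sub>R (\<Sum>i=1..t. gradient f (x i) + \<xi> i)"
  defines "a \<equiv> inv_step L \<sigma>" and "b \<equiv> inv_step_diff \<sigma>"
  defines "\<kappa> \<equiv> \<lambda>t. (L + b t) / a t" and "h \<equiv> \<lambda>t. gradient f (x t) + b t *\<^sub>R x t"
  shows "(\<Sum>t=1..n. (1 - \<kappa> t / 2) / a t * (norm (h t))\<^sup>2 + (norm (b t *\<^sub>R x t))\<^sup>2 / (2 * a t)
            + (1 - \<kappa> t) / a t * (h t \<bullet> \<xi> t) - \<kappa> t / (2 * a t) * (norm (\<xi> t))\<^sup>2)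
         \<le> f 0 - (f (x (Suc n)) + b n / 2 * (norm (x (Suc n)))\<^sup>2)"
proof (induction n)
  case 0
  then show ?case using x1 by simp
next
  case (Suc n)
  let ?m = "Suc n"
  have apos: "0 < a t" for t using assms(1,2) by (auto simp: a_def inv_step_def intro!: add_pos_nonneg)
  define S where "S = (\<lambda>t. \<Sum>i=1..t. gradient f (x i) + \<xi> i)"
  \<comment> \<open>It also holds at \<open>t = 0\<close>, where the sum is empty and
    \<open>x 1 = 0\<close>, so the first step is no special case below.\<close>
  have ax: "a t *\<^sub>R x (Suc t) = - S t" for t
  proof (cases "t \<ge> 1")
    case True
    then show ?thesis using iter[OF True] apos[of t] by (simp add: a_def S_def)
  next
    case False
    then show ?thesis using x1 by (simp add: S_def not_le)
  qed
  \<comment> \<open>Splitting \<open>a ?m = a n + b ?m\<close> and using \<open>ax\<close> twice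
    cancels all old gradients: dual averaging becomes one step along the newest gradient plus a pull
    towards 0.\<close>
  have "a ?m *\<^sub>R (x (Suc ?m) - x ?m) = a ?m *\<^sub>R x (Suc ?m) - (a n + b ?m) *\<^sub>R x ?m"
    unfolding a_def b_def inv_step_Suc[symmetric] by (simp add: scaleR_diff_right)
  also have "\<dots> = - S ?m + S n - b ?m *\<^sub>R x ?m"
    by (simp add: ax scaleR_add_left)
  also have "\<dots> = - (h ?m + \<xi> ?m)"
    by (simp add: S_def h_def)
  finally have step: "a ?m *\<^sub>R (x (Suc ?m) - x ?m) = - (h ?m + \<xi> ?m)" .
  have desc: "f (x (Suc ?m)) + b ?m / 2 * (norm (x (Suc ?m)))\<^sup>2
      \<le> f (x ?m) + b ?m / 2 * (norm (x ?m))\<^sup>2 - (1 - \<kappa> ?m / 2) / a ?m * (norm (h ?m))\<^sup>2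
           - (1 - \<kappa> ?m) / a ?m * (h ?m \<bullet> \<xi> ?m) + \<kappa> ?m / (2 * a ?m) * (norm (\<xi> ?m))\<^sup>2"
    by (rule regularized_descent_step[OF smooth apos step]) (simp_all add: h_def \<kappa>_def)
  have "(norm (b ?m *\<^sub>R x ?m))\<^sup>2 / (2 * a ?m) \<le> (b n - b ?m) / 2 * (norm (x ?m))\<^sup>2"
  proof (cases "n = 0")
    case True
    then show ?thesis using x1 by simp
  next
    case False
    then have "(b ?m)\<^sup>2 \<le> a ?m * (b n - b ?m)"
      unfolding a_def b_def using assms(1,2) by (intro inv_step_diff_square_le) auto
    then have "(b ?m)\<^sup>2 * (norm (x ?m))\<^sup>2 \<le> a ?m * (b n - b ?m) * (norm (x ?m))\<^sup>2"
      by (rule mult_right_mono) simp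
    then show ?thesis using apos[of ?m] by (simp add: power_mult_distrib field_simps)
  qed
  then have "b ?m / 2 * (norm (x ?m))\<^sup>2 + (norm (b ?m *\<^sub>R x ?m))\<^sup>2 / (2 * a ?m)
      \<le> b n / 2 * (norm (x ?m))\<^sup>2"
    by (simp add: left_diff_distrib diff_divide_distrib)
  then show ?case using Suc.IH desc by simp
qed

subsection \<open>Measurability of the iterates and the tail bound\<close>

lemma space_past [simp]: "space (past M \<xi> t) = space M"
  unfolding past_def by (rule space_measure_of) auto

lemma measurable_past:
  fixes \<xi> :: "nat \<Rightarrow> 'w \<Rightarrow> 'a::topological_space"
  assumes "1 \<le> i" "i < t"
  shows "\<xi> i \<in> borel_measurable (past M \<xi> t)"
proof (rule measurableI)
  fix A :: "'a set" assume "A \<in> sets borel"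
  then have "\<xi> i -` A \<inter> space M \<in> (\<Union>i\<in>{1..<t}. {\<xi> i -` A \<inter> space M | A. A \<in> sets borel})"
    using assms by (intro UN_I[of i]) auto
  then show "\<xi> i -` A \<inter> space (past M \<xi> t) \<in> sets (past M \<xi> t)"
    unfolding space_past unfolding past_def by (subst sets_measure_of) (blast, rule sigma_sets.Basic)
qed auto

text \<open>Each oracle answer is rewritten as gradient plus noise. An iterate is thus a measurable
  function of earlier iterates and noises, and strong induction applies.\<close>

lemma sda_iterates_measurable_past:
  fixes f :: "'a::euclidean_space \<Rightarrow> real"
  assumes it: "sda_iterates M \<eta> G x" and grad: "gradient f \<in> borel_measurable borel"
    and "1 \<le> s" "s \<le> t"
  shows "x s \<in> borel_measurable (past M (noise f G x) t)"
  using assms(3,4)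
proof (induction s rule: less_induct)
  case (less s)
  let ?F = "past M (noise f G x) t"
  show ?case
  proof (cases "s = 1")
    case True
    have "x 1 \<in> borel_measurable ?F \<longleftrightarrow> (\<lambda>\<omega>. 0 :: 'a) \<in> borel_measurable ?F"
      by (rule measurable_cong) (use it in \<open>auto simp: sda_iterates_def\<close>)
    with True show ?thesis by simp
  next
    case False
    with less.prems have s: "s = (s - 1) + 1" "1 \<le> s - 1" by auto
    let ?y = "\<lambda>\<omega>. - \<eta> (s - 1) *\<^sub>R (\<Sum>i=1..s - 1. gradient f (x i \<omega>) + noise f G x i \<omega>)"
    have "x s \<omega> = ?y \<omega>" if "\<omega> \<in> space M" for \<omega>
    proof -
      have "x ((s - 1) + 1) \<omega> = - \<eta> (s - 1) *\<^sub>R (\<Sum>i=1..s - 1. G i (x i \<omega>) \<omega>)"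
        using it that s(2) unfolding sda_iterates_def by blast
      then show ?thesis unfolding s(1)[symmetric] by (simp add: noise_def)
    qed
    then have "x s \<in> borel_measurable ?F \<longleftrightarrow> ?y \<in> borel_measurable ?F"
      by (intro measurable_cong) simp
    moreover have "?y \<in> borel_measurable ?F"
    proof (intro borel_measurable_scaleR borel_measurable_sum borel_measurable_add borel_measurable_const)
      fix i assume "i \<in> {1..s - 1}"
      with less.prems have i: "1 \<le> i" "i < s" "i < t" by auto
      from less.IH[OF i(2,1)] i have "x i \<in> borel_measurable ?F" by simp
      then show "(\<lambda>\<omega>. gradient f (x i \<omega>)) \<in> borel_measurable ?F"
        by (rule measurable_compose[OF _ grad])
      show "noise f G x i \<in> borel_measurable ?F" using i by (intro measurable_past) auto
    qed
    ultimately show ?thesis by simp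
  qed
qed

section \<open>Absorbing the noise and assembling the bound\<close>

text \<open>\<open>u\<close> and \<open>s\<close> are chosen so that all terms in
  \<open>\<xi>\<close> cancel, leaving the compensators. The one from \<open>u\<close> costs at most
  \<open>(1 - \<kappa>) / 3\<close> of the coefficient \<open>1 - \<kappa> / 2\<close>, so at least
  \<open>1 / 2\<close> survives. With \<open>(norm (h - v))\<^sup>2 \<le> 2 * ((norm h)\<^sup>2 +
  (norm v)\<^sup>2)\<close> this gives the factor \<open>1 / (4 * a)\<close>.\<close>

lemma martingale_term_absorbed:
  fixes h v \<xi> :: "'a::real_inner"
  assumes a: "0 < a" and \<kappa>: "0 \<le> \<kappa>" "\<kappa> \<le> 1" and l: "0 < l" "6 * \<sigma>\<^sup>2 * l \<le> a"
  defines "u \<equiv> - (l * (1 - \<kappa>) / a) *\<^sub>R h" and "s \<equiv> l * \<kappa> / (2 * a)"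
  shows "(norm (h - v))\<^sup>2 / (4 * a)
      \<le> ((1 - \<kappa> / 2) / a * (norm h)\<^sup>2 + (norm v)\<^sup>2 / (2 * a)
            + (1 - \<kappa>) / a * (h \<bullet> \<xi>) - \<kappa> / (2 * a) * (norm \<xi>)\<^sup>2)
        + (u \<bullet> \<xi> + s * (norm \<xi>)\<^sup>2 - (2 * \<sigma>\<^sup>2 * (norm u)\<^sup>2 + s * \<sigma>\<^sup>2)) / l
        + \<kappa> * \<sigma>\<^sup>2 / (2 * a)"
proof -
  define H V I N where "H = (norm h)\<^sup>2" and "V = (norm v)\<^sup>2" and "I = h \<bullet> \<xi>" and "N = (norm \<xi>)\<^sup>2"
  have HV: "0 \<le> H" "0 \<le> V" by (auto simp: H_def V_def)
  have "(norm (h - v))\<^sup>2 \<le> (norm (h - v))\<^sup>2 + (norm (h + v))\<^sup>2" by simp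
  also have "\<dots> = 2 * (H + V)"
    unfolding H_def V_def power2_norm_eq_inner by (simp add: inner_diff inner_add inner_commute)
  finally have "(norm (h - v))\<^sup>2 \<le> 2 * (H + V)" .
  then have 1: "(norm (h - v))\<^sup>2 / (4 * a) \<le> 2 * (H + V) / (4 * a)"
    using a by (intro divide_right_mono) auto
  have "2 * \<sigma>\<^sup>2 * l * (1 - \<kappa>)\<^sup>2 / a \<le> (1 - \<kappa>)\<^sup>2 / 3"
    using mult_right_mono[OF l(2), of "(1 - \<kappa>)\<^sup>2"] a by (simp add: field_simps)
  also have "\<dots> \<le> (1 - \<kappa>) / 3"
    using \<kappa> by (simp add: power2_eq_square mult_left_le)
  also have "\<dots> \<le> (1 - \<kappa> / 2) - 1 / 2" using \<kappa> by simp
  finally have "1 / 2 * H \<le> ((1 - \<kappa> / 2) - 2 * \<sigma>\<^sup>2 * l * (1 - \<kappa>)\<^sup>2 / a) * H"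
    using HV by (intro mult_right_mono) auto
  moreover have "2 * (H + V) / (4 * a) = (1 / 2 * H + V / 2) / a"
    using a by (simp add: field_simps)
  ultimately have "2 * (H + V) / (4 * a) \<le> (((1 - \<kappa> / 2) - 2 * \<sigma>\<^sup>2 * l * (1 - \<kappa>)\<^sup>2 / a) * H + V / 2) / a"
    using a by (simp add: divide_right_mono)
  also have "\<dots> = (1 - \<kappa> / 2) / a * H + V / (2 * a) - 2 * \<sigma>\<^sup>2 * l * (1 - \<kappa>)\<^sup>2 / a\<^sup>2 * H"
    using a by (simp add: field_simps power2_eq_square)
  finally have 2: "2 * (H + V) / (4 * a)
      \<le> (1 - \<kappa> / 2) / a * H + V / (2 * a) - 2 * \<sigma>\<^sup>2 * l * (1 - \<kappa>)\<^sup>2 / a\<^sup>2 * H" .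
  have u2: "(norm u)\<^sup>2 = l\<^sup>2 * (1 - \<kappa>)\<^sup>2 / a\<^sup>2 * H"
    by (simp add: u_def H_def power_mult_distrib power_divide)
  have uI: "u \<bullet> \<xi> = - (l * (1 - \<kappa>) / a * I)" by (simp add: u_def I_def)
  have 3: "(u \<bullet> \<xi> + s * N - (2 * \<sigma>\<^sup>2 * (norm u)\<^sup>2 + s * \<sigma>\<^sup>2)) / l
      = - ((1 - \<kappa>) / a * I) + \<kappa> / (2 * a) * N - 2 * \<sigma>\<^sup>2 * l * (1 - \<kappa>)\<^sup>2 / a\<^sup>2 * H - \<kappa> * \<sigma>\<^sup>2 / (2 * a)"
    unfolding u2 uI s_def using a l(1)
    by (simp add: field_simps power2_eq_square)
  show ?thesis
    using 1 2 unfolding H_def[symmetric] V_def[symmetric] I_def[symmetric] N_def[symmetric] 3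
    by linarith
qed

theorem theorem5p4:
  fixes f :: "real ^ 'd \<Rightarrow> real"
    and M :: "'w measure"
    and G :: "nat \<Rightarrow> real ^ 'd \<Rightarrow> 'w \<Rightarrow> real ^ 'd"
    and x :: "nat \<Rightarrow> 'w \<Rightarrow> real ^ 'd"
    and L \<sigma> \<delta> :: real
    and T :: nat
  assumes "L > 0"
    and "L_smooth L f"
    and "bdd_below (range f)"
    and "\<sigma> > 0"
    and "prob_space M"
    and "independent_queries M G"
    and "unbiased_oracle M f G"
    and "subgaussian_oracle M f G \<sigma>"
    and "sda_iterates M (\<lambda>t. 1 / (L + \<sigma> * sqrt (real t))) G x"
    and "cond_unbiased M (noise f G x)"
    and "cond_subgaussian M (noise f G x) \<sigma>"
    and "T \<ge> 1"
    and "0 < \<delta>" "\<delta> < 1"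
  defines "\<Delta> \<equiv> f 0 - (INF y. f y)"
  shows "measure M {\<omega> \<in> space M.
           1 / real T * (\<Sum>t=1..T. (norm (gradient f (x t \<omega>)))\<^sup>2)
             \<le> (6 * \<Delta> + 18 * (L + \<sigma>) * ln (1 + \<sigma> * sqrt (real T) / L)
                  + 36 * \<sigma>\<^sup>2 / (L + \<sigma>) * ln (1 / \<delta>))
               * ((L + \<sigma> * sqrt (real T)) / real T)}
         \<ge> 1 - \<delta>"
proof -
  interpret prob_space M by fact
  let ?\<xi> = "noise f G x"
  define F where "F = past M ?\<xi>"
  define a where "a = inv_step L \<sigma>"
  define b where "b = inv_step_diff \<sigma>"
  define \<kappa> where "\<kappa> = (\<lambda>t. (L + b t) / a t)"
  \<comment> \<open>Chosen so that \<open>6 * \<sigma>\<^sup>2 * l = L + \<sigma>\<close>, which is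
    at most every \<open>a t\<close> with \<open>t \<ge> 1\<close>: one constant meets the
    absorption condition at all times.\<close>
  define l where "l = (L + \<sigma>) / (6 * \<sigma>\<^sup>2)"
  define h where "h = (\<lambda>t \<omega>. gradient f (x t \<omega>) + b t *\<^sub>R x t \<omega>)"
  define u where "u = (\<lambda>t \<omega>. - (l * (1 - \<kappa> t) / a t) *\<^sub>R h t \<omega>)"
  define s where "s = (\<lambda>t. l * \<kappa> t / (2 * a t))"
  define X where "X = (\<lambda>t \<omega>. u t \<omega> \<bullet> ?\<xi> t \<omega> + s t * (norm (?\<xi> t \<omega>))\<^sup>2
      - (2 * \<sigma>\<^sup>2 * (norm (u t \<omega>))\<^sup>2 + s t * \<sigma>\<^sup>2))"
  define R where "R = ln (1 + \<sigma> * sqrt (real T) / L)"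

  have a_ge: "L + \<sigma> \<le> a t" and b: "0 \<le> b t" "b t \<le> \<sigma>" if "1 \<le> t" for t
    using inv_step_ge[of \<sigma> t L] inv_step_diff_bounds[of \<sigma> t] that \<open>\<sigma> > 0\<close> by (auto simp: a_def b_def)
  have apos: "0 < a t" if "1 \<le> t" for t using a_ge[OF that] \<open>L > 0\<close> \<open>\<sigma> > 0\<close> by simp
  have \<kappa>: "0 \<le> \<kappa> t" "\<kappa> t \<le> 1" if "1 \<le> t" for t
    using a_ge[OF that] b[OF that] apos[OF that] \<open>L > 0\<close> by (auto simp: \<kappa>_def)
  have l: "0 < l" "6 * \<sigma>\<^sup>2 * l = L + \<sigma>" using \<open>L > 0\<close> \<open>\<sigma> > 0\<close> by (auto simp: l_def)
  have s: "0 \<le> s t" "2 * s t * \<sigma>\<^sup>2 \<le> 1" if "1 \<le> t" for t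
  proof -
    show "0 \<le> s t" unfolding s_def using l(1) \<kappa>[OF that] apos[OF that] by simp
    have "\<sigma>\<^sup>2 * l \<le> a t" using l(2) a_ge[OF that] \<open>L > 0\<close> \<open>\<sigma> > 0\<close> by linarith
    then have "\<sigma>\<^sup>2 * l * \<kappa> t \<le> a t * 1"
      using \<kappa>[OF that] apos[OF that] by (intro mult_mono) auto
    then show "2 * s t * \<sigma>\<^sup>2 \<le> 1"
      using apos[OF that] by (simp add: s_def field_simps)
  qed

  have diff: "f differentiable (at y)" for y using \<open>L_smooth L f\<close> by (auto simp: L_smooth_def)
  note grad = borel_measurable_gradient[OF diff]
  have \<xi>int: "integrable M (?\<xi> t)" and unb: "AE \<omega> in M. vec_cond_exp M (F t) (?\<xi> t) \<omega> = 0"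
    if "1 \<le> t" for t
    using \<open>cond_unbiased M ?\<xi>\<close> that by (auto simp: cond_unbiased_def F_def)
  have \<xi>M: "?\<xi> t \<in> borel_measurable M" if "1 \<le> t" for t using \<xi>int[OF that] by auto
  have sub: "subalgebra M (F t)" for t unfolding F_def by (rule subalgebra_past) (rule \<xi>M)
  have xF: "x r \<in> borel_measurable (F t)" if "1 \<le> r" "r \<le> t" for r t
    unfolding F_def by (rule sda_iterates_measurable_past[OF \<open>sda_iterates M _ G x\<close> grad that])
  have gF: "(\<lambda>\<omega>. gradient f (x r \<omega>)) \<in> borel_measurable (F t)" if "1 \<le> r" "r \<le> t" for r t
    by (rule measurable_compose[OF xF[OF that] grad])
  have uF: "u r \<in> borel_measurable (F t)" if "1 \<le> r" "r \<le> t" for r t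
    unfolding u_def h_def using xF[OF that] gF[OF that] by measurable
  have sg: "AE \<omega> in M. nn_cond_exp M (F t) (\<lambda>\<omega>. ennreal (exp ((norm (?\<xi> t \<omega>))\<^sup>2 / \<sigma>\<^sup>2))) \<omega>
      \<le> ennreal (exp 1)" if "1 \<le> t" for t
  proof -
    have "\<bar>1 / \<sigma>\<bar> \<le> 1 / \<sigma>" using \<open>\<sigma> > 0\<close> by simp
    with \<open>cond_subgaussian M ?\<xi> \<sigma>\<close> that
    have "AE \<omega> in M. nn_cond_exp M (F t) (\<lambda>\<omega>. ennreal (exp ((1 / \<sigma>)\<^sup>2 * (norm (?\<xi> t \<omega>))\<^sup>2))) \<omega>
        \<le> ennreal (exp ((1 / \<sigma>)\<^sup>2 * \<sigma>\<^sup>2))"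
      unfolding cond_subgaussian_def F_def by blast
    then show ?thesis using \<open>\<sigma> > 0\<close> by (simp add: power_divide)
  qed

  \<comment> \<open>All randomness is handled by this event for the compensated noise
    \<open>X\<close>; what follows is a deterministic argument along each of its
    trajectories.\<close>
  have "1 - \<delta> \<le> measure M {\<omega> \<in> space M. (\<Sum>t=1..T. X t \<omega>) \<le> ln (1 / \<delta>)}"
  proof (rule prob_sum_le_ln[OF \<open>prob_space M\<close> sub _ _ _ \<open>0 < \<delta>\<close>])
    show "X t \<in> borel_measurable M" if "1 \<le> t" for t
      unfolding X_def using \<xi>M[OF that] measurable_from_subalg[OF sub uF[OF that order_refl]]
      by measurable
    show "X r \<in> borel_measurable (F t)" if "1 \<le> r" "r < t" for r t
    proof -
      have [measurable]: "u r \<in> borel_measurable (F t)" using that by (intro uF) auto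
      have [measurable]: "?\<xi> r \<in> borel_measurable (F t)"
        unfolding F_def using that by (rule measurable_past)
      show ?thesis unfolding X_def by measurable
    qed
    show "AE \<omega> in M. nn_cond_exp M (F t) (\<lambda>\<omega>. ennreal (exp (X t \<omega>))) \<omega> \<le> 1" if "1 \<le> t" for t
      unfolding X_def using that
      by (intro nn_cond_exp_exp_le_1[OF \<open>prob_space M\<close> sub \<open>\<sigma> > 0\<close>] \<xi>int unb sg uF s) auto
  qed
  also have "\<dots> \<le> measure M {\<omega> \<in> space M.
           1 / real T * (\<Sum>t=1..T. (norm (gradient f (x t \<omega>)))\<^sup>2)
             \<le> (6 * \<Delta> + 18 * (L + \<sigma>) * R + 36 * \<sigma>\<^sup>2 / (L + \<sigma>) * ln (1 / \<delta>))
               * ((L + \<sigma> * sqrt (real T)) / real T)}" (is "_ \<le> measure M ?E")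
  proof (rule finite_measure_mono)
    have [measurable]: "(\<lambda>\<omega>. gradient f (x t \<omega>)) \<in> borel_measurable M" if "1 \<le> t" for t
      by (rule measurable_from_subalg[OF sub gF[OF that order_refl]])
    have [measurable]: "(\<lambda>\<omega>. \<Sum>t=1..T. (norm (gradient f (x t \<omega>)))\<^sup>2) \<in> borel_measurable M"
      by (intro borel_measurable_sum borel_measurable_power borel_measurable_norm) simp
    show "?E \<in> sets M" by measurable
    show "{\<omega> \<in> space M. (\<Sum>t=1..T. X t \<omega>) \<le> ln (1 / \<delta>)} \<subseteq> ?E"
    proof safe
      fix \<omega> assume \<omega>: "\<omega> \<in> space M" and XS: "(\<Sum>t=1..T. X t \<omega>) \<le> ln (1 / \<delta>)"
      let ?g = "\<lambda>t. (norm (gradient f (x t \<omega>)))\<^sup>2"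
      let ?D = "\<lambda>t. (1 - \<kappa> t / 2) / a t * (norm (h t \<omega>))\<^sup>2 + (norm (b t *\<^sub>R x t \<omega>))\<^sup>2 / (2 * a t)
            + (1 - \<kappa> t) / a t * (h t \<omega> \<bullet> ?\<xi> t \<omega>) - \<kappa> t / (2 * a t) * (norm (?\<xi> t \<omega>))\<^sup>2"
      have x1: "x 1 \<omega> = 0" and iter: "x (t + 1) \<omega> = - (1 / inv_step L \<sigma> t) *\<^sub>R
          (\<Sum>i=1..t. gradient f (x i \<omega>) + ?\<xi> i \<omega>)" if "1 \<le> t" for t
        using \<open>sda_iterates M _ G x\<close> \<omega> that by (auto simp: sda_iterates_def noise_def inv_step_def)
      have D: "(\<Sum>t=1..T. ?D t) \<le> f 0 - (f (x (Suc T) \<omega>) + b T / 2 * (norm (x (Suc T) \<omega>))\<^sup>2)"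
        unfolding \<kappa>_def h_def a_def b_def
        using x1 by (intro sda_energy_bound[OF \<open>L > 0\<close> \<open>\<sigma> > 0\<close> \<open>L_smooth L f\<close> _ iter]) auto
      also have "\<dots> \<le> \<Delta>"
        using cINF_lower[OF \<open>bdd_below (range f)\<close>, of "x (Suc T) \<omega>"]
          mult_nonneg_nonneg[OF b(1)[OF \<open>T \<ge> 1\<close>] zero_le_power2[of "norm (x (Suc T) \<omega>)"]]
        by (simp add: \<Delta>_def)
      finally have D: "(\<Sum>t=1..T. ?D t) \<le> \<Delta>" .
      have "?g t / (4 * a T) \<le> ?D t + X t \<omega> / l + (L + \<sigma>) / 2 * (\<sigma>\<^sup>2 / (a t)\<^sup>2)"
        if t: "t \<in> {1..T}" for t
      proof -
        from t have t1: "1 \<le> t" by simp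
        \<comment> \<open>Passing to the largest inverse step gives all squared gradients a common
          weight.\<close>
        have "a t \<le> a T" using t \<open>\<sigma> > 0\<close> by (auto simp: a_def intro: inv_step_mono)
        then have "?g t / (4 * a T) \<le> ?g t / (4 * a t)"
          using apos[OF t1] by (intro divide_left_mono) auto
        also have "\<dots> = (norm (h t \<omega> - b t *\<^sub>R x t \<omega>))\<^sup>2 / (4 * a t)" by (simp add: h_def)
        also have "\<dots> \<le> ?D t + X t \<omega> / l + \<kappa> t * \<sigma>\<^sup>2 / (2 * a t)"
          unfolding X_def u_def s_def
          using apos[OF t1] \<kappa>[OF t1] l a_ge[OF t1] by (intro martingale_term_absorbed) auto
        also have "\<kappa> t * \<sigma>\<^sup>2 / (2 * a t) = (L + b t) / 2 * (\<sigma>\<^sup>2 / (a t)\<^sup>2)"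
          by (simp add: \<kappa>_def power2_eq_square)
        \<comment> \<open>With \<open>b t \<le> \<sigma>\<close>, the leftover noise becomes a
          constant times the logarithmically summable sequence.\<close>
        also have "\<dots> \<le> (L + \<sigma>) / 2 * (\<sigma>\<^sup>2 / (a t)\<^sup>2)"
          using b[OF t1] by (intro mult_right_mono) auto
        finally show ?thesis by simp
      qed
      then have "(\<Sum>t=1..T. ?g t / (4 * a T))
          \<le> (\<Sum>t=1..T. ?D t + X t \<omega> / l + (L + \<sigma>) / 2 * (\<sigma>\<^sup>2 / (a t)\<^sup>2))"
        by (rule sum_mono)
      also have "\<dots> = (\<Sum>t=1..T. ?D t) + (\<Sum>t=1..T. X t \<omega>) / l
          + (L + \<sigma>) / 2 * (\<Sum>t=1..T. \<sigma>\<^sup>2 / (a t)\<^sup>2)"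
        by (simp only: sum.distrib sum_divide_distrib sum_distrib_left)
      also have "\<dots> \<le> \<Delta> + ln (1 / \<delta>) / l + (L + \<sigma>) / 2 * (2 * R)"
        using D XS l(1) \<open>L > 0\<close> \<open>\<sigma> > 0\<close> sum_inv_step_square_le[OF \<open>\<sigma> > 0\<close> \<open>L > 0\<close>, of T]
        by (intro add_mono divide_right_mono mult_left_mono) (auto simp: R_def a_def)
      \<comment> \<open>Since \<open>1 / l = 6 * \<sigma>\<^sup>2 / (L + \<sigma>)\<close>, the left
        side is \<open>\<Delta> + 6 * Q + P\<close>. The divisor 4 matches \<open>4 * a T\<close>,
        and nonnegativity of the three quantities absorbs the slack in the constants.\<close>
      also have "\<dots> \<le> (6 * \<Delta> + 18 * (L + \<sigma>) * R + 36 * \<sigma>\<^sup>2 / (L + \<sigma>) * ln (1 / \<delta>)) / 4"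
      proof -
        have "(INF y. f y) \<le> f 0" using \<open>bdd_below (range f)\<close> by (intro cINF_lower) auto
        then have "0 \<le> \<Delta>" by (simp add: \<Delta>_def)
        define P Q where "P = (L + \<sigma>) * R" and "Q = \<sigma>\<^sup>2 / (L + \<sigma>) * ln (1 / \<delta>)"
        have "0 \<le> P"
          using \<open>L > 0\<close> \<open>\<sigma> > 0\<close> by (auto simp: P_def R_def intro!: mult_nonneg_nonneg)
        moreover have "0 \<le> Q" unfolding Q_def
          using \<open>L > 0\<close> \<open>\<sigma> > 0\<close> \<open>0 < \<delta>\<close> \<open>\<delta> < 1\<close> by (intro mult_nonneg_nonneg) auto
        ultimately have "\<Delta> + 6 * Q + P \<le> (6 * \<Delta> + 18 * P + 36 * Q) / 4"
          using \<open>0 \<le> \<Delta>\<close> by simp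
        moreover have "\<Delta> + ln (1 / \<delta>) / l + (L + \<sigma>) / 2 * (2 * R) = \<Delta> + 6 * Q + P"
          by (simp add: P_def Q_def l_def mult.commute)
        moreover have "18 * (L + \<sigma>) * R = 18 * P" unfolding P_def by (rule mult.assoc)
        moreover have "36 * \<sigma>\<^sup>2 / (L + \<sigma>) * ln (1 / \<delta>) = 36 * Q" by (simp add: Q_def)
        ultimately show ?thesis by (simp only:)
      qed
      finally have "(\<Sum>t=1..T. ?g t) \<le> (6 * \<Delta> + 18 * (L + \<sigma>) * R + 36 * \<sigma>\<^sup>2 / (L + \<sigma>) * ln (1 / \<delta>)) * a T"
        using apos[OF \<open>T \<ge> 1\<close>] by (simp add: sum_divide_distrib[symmetric] pos_divide_le_eq)
      then have "(\<Sum>t=1..T. ?g t) / real T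
          \<le> (6 * \<Delta> + 18 * (L + \<sigma>) * R + 36 * \<sigma>\<^sup>2 / (L + \<sigma>) * ln (1 / \<delta>)) * a T / real T"
        by (rule divide_right_mono) simp
      then show "1 / real T * (\<Sum>t=1..T. ?g t)
             \<le> (6 * \<Delta> + 18 * (L + \<sigma>) * R + 36 * \<sigma>\<^sup>2 / (L + \<sigma>) * ln (1 / \<delta>))
               * ((L + \<sigma> * sqrt (real T)) / real T)"
        by (simp add: a_def inv_step_def)
    qed
  qed
  finally show ?thesis unfolding R_def .
qed

end
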